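(* Let $\mathcal{A}$ be an Abelian category, let $M\twoheadrightarrow T$ and $N\twoheadrightarrow T$ be epimorphisms in $\mathcal{A}$, and let $P\cong M\times_T N$ be their pullback, with projections $P\twoheadrightarrow M$ and $P\twoheadrightarrow N$ (which are epimorphisms). If $\operatorname{Hom}(T,M)=0$ and $\operatorname{Ext}^1(T,P)=0$, then the epimorphism $P\twoheadrightarrow M$ is split and $M$ is isomorphic to a direct summand of $P$. If furthermore $P$ is projective, then $M$ is projective.
   Context: $\operatorname{Ext}^1(X,Y)$ denotes the (Yoneda) group of equivalence classes of extensions $0\to Y\to E\to X\to 0$ in $\mathcal{A}$. *)

theory Defs
  imports "HOL-Algebra.Group"
begin
text \<open>Composition is written in the applicative order: \<open>g \<cdot> f\<close> is \<open>g\<close> after \<open>f\<close>.\<close>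

record ('o, 'm) category =
  Obj :: "'o set"
  Arr :: "'m set"
  Dom :: "'m \<Rightarrow> 'o"
  Cod :: "'m \<Rightarrow> 'o"
  Id :: "'o \<Rightarrow> 'm"
  Comp :: "'m \<Rightarrow> 'm \<Rightarrow> 'm" (infixr "\<cdot>\<index>" 70)

definition Hom :: "('o, 'm, 'r) category_scheme \<Rightarrow> 'o \<Rightarrow> 'o \<Rightarrow> 'm set" where
  "Hom C X Y = {f \<in> Arr C. Dom C f = X \<and> Cod C f = Y}"

locale category =
  fixes C :: "('o, 'm, 'r) category_scheme" (structure)
  assumes Dom_in_Obj: "f \<in> Arr C \<Longrightarrow> Dom C f \<in> Obj C"
    and Cod_in_Obj: "f \<in> Arr C \<Longrightarrow> Cod C f \<in> Obj C"
    and Id_in_Hom: "X \<in> Obj C \<Longrightarrow> Id C X \<in> Hom C X X"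
    and Comp_in_Hom: "\<lbrakk>f \<in> Hom C X Y; g \<in> Hom C Y Z\<rbrakk> \<Longrightarrow> g \<cdot> f \<in> Hom C X Z"
    and Comp_Id: "f \<in> Hom C X Y \<Longrightarrow> f \<cdot> Id C X = f"
    and Id_Comp: "f \<in> Hom C X Y \<Longrightarrow> Id C Y \<cdot> f = f"
    and Comp_assoc: "\<lbrakk>f \<in> Hom C W X; g \<in> Hom C X Y; h \<in> Hom C Y Z\<rbrakk>
      \<Longrightarrow> (h \<cdot> g) \<cdot> f = h \<cdot> (g \<cdot> f)"

definition monic :: "('o, 'm, 'r) category_scheme \<Rightarrow> 'm \<Rightarrow> bool" where
  "monic C m \<longleftrightarrow> m \<in> Arr C \<and>
     (\<forall>W. \<forall>a \<in> Hom C W (Dom C m). \<forall>b \<in> Hom C W (Dom C m).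
        m \<cdot>\<^bsub>C\<^esub> a = m \<cdot>\<^bsub>C\<^esub> b \<longrightarrow> a = b)"

definition epic :: "('o, 'm, 'r) category_scheme \<Rightarrow> 'm \<Rightarrow> bool" where
  "epic C e \<longleftrightarrow> e \<in> Arr C \<and>
     (\<forall>Z. \<forall>a \<in> Hom C (Cod C e) Z. \<forall>b \<in> Hom C (Cod C e) Z.
        a \<cdot>\<^bsub>C\<^esub> e = b \<cdot>\<^bsub>C\<^esub> e \<longrightarrow> a = b)"

definition split_epic :: "('o, 'm, 'r) category_scheme \<Rightarrow> 'm \<Rightarrow> bool" where
  "split_epic C e \<longleftrightarrow> e \<in> Arr C \<and>
     (\<exists>s \<in> Hom C (Cod C e) (Dom C e). e \<cdot>\<^bsub>C\<^esub> s = Id C (Cod C e))"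

definition iso_arr :: "('o, 'm, 'r) category_scheme \<Rightarrow> 'm \<Rightarrow> bool" where
  "iso_arr C f \<longleftrightarrow> f \<in> Arr C \<and>
     (\<exists>g \<in> Hom C (Cod C f) (Dom C f).
        g \<cdot>\<^bsub>C\<^esub> f = Id C (Dom C f) \<and> f \<cdot>\<^bsub>C\<^esub> g = Id C (Cod C f))"

definition isomorphic :: "('o, 'm, 'r) category_scheme \<Rightarrow> 'o \<Rightarrow> 'o \<Rightarrow> bool" where
  "isomorphic C X Y \<longleftrightarrow> (\<exists>f \<in> Hom C X Y. iso_arr C f)"

definition zero_object :: "('o, 'm, 'r) category_scheme \<Rightarrow> 'o \<Rightarrow> bool" where
  "zero_object C Z \<longleftrightarrow> Z \<in> Obj C \<and>
     (\<forall>X \<in> Obj C. (\<exists>!f. f \<in> Hom C X Z) \<and> (\<exists>!f. f \<in> Hom C Z X))"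

definition is_pullback ::
  "('o, 'm, 'r) category_scheme \<Rightarrow> 'm \<Rightarrow> 'm \<Rightarrow> 'o \<Rightarrow> 'm \<Rightarrow> 'm \<Rightarrow> bool" where
  "is_pullback C f g P p q \<longleftrightarrow>
     f \<in> Arr C \<and> g \<in> Arr C \<and> Cod C f = Cod C g \<and>
     p \<in> Hom C P (Dom C f) \<and> q \<in> Hom C P (Dom C g) \<and>
     f \<cdot>\<^bsub>C\<^esub> p = g \<cdot>\<^bsub>C\<^esub> q \<and>
     (\<forall>W. \<forall>a \<in> Hom C W (Dom C f). \<forall>b \<in> Hom C W (Dom C g).
        f \<cdot>\<^bsub>C\<^esub> a = g \<cdot>\<^bsub>C\<^esub> b \<longrightarrow>
        (\<exists>!u. u \<in> Hom C W P \<and> p \<cdot>\<^bsub>C\<^esub> u = a \<and> q \<cdot>\<^bsub>C\<^esub> u = b))"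

definition projective :: "('o, 'm, 'r) category_scheme \<Rightarrow> 'o \<Rightarrow> bool" where
  "projective C P \<longleftrightarrow> P \<in> Obj C \<and>
     (\<forall>e f. epic C e \<and> f \<in> Hom C P (Cod C e) \<longrightarrow>
        (\<exists>h \<in> Hom C P (Dom C e). e \<cdot>\<^bsub>C\<^esub> h = f))"

record ('o, 'm) preadditive = "('o, 'm) category" +
  Add :: "'m \<Rightarrow> 'm \<Rightarrow> 'm" (infixl "\<boxplus>\<index>" 65)
  Zero :: "'o \<Rightarrow> 'o \<Rightarrow> 'm"

definition Hom_group :: "('o, 'm, 'r) preadditive_scheme \<Rightarrow> 'o \<Rightarrow> 'o \<Rightarrow> 'm monoid" where
  "Hom_group C X Y = \<lparr>carrier = Hom C X Y, mult = Add C, one = Zero C X Y\<rparr>"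

definition is_kernel :: "('o, 'm, 'r) preadditive_scheme \<Rightarrow> 'm \<Rightarrow> 'm \<Rightarrow> bool" where
  "is_kernel C k f \<longleftrightarrow> k \<in> Arr C \<and> f \<in> Arr C \<and> Cod C k = Dom C f \<and>
     f \<cdot>\<^bsub>C\<^esub> k = Zero C (Dom C k) (Cod C f) \<and>
     (\<forall>W. \<forall>h \<in> Hom C W (Dom C f). f \<cdot>\<^bsub>C\<^esub> h = Zero C W (Cod C f) \<longrightarrow>
        (\<exists>!u. u \<in> Hom C W (Dom C k) \<and> k \<cdot>\<^bsub>C\<^esub> u = h))"

definition is_cokernel :: "('o, 'm, 'r) preadditive_scheme \<Rightarrow> 'm \<Rightarrow> 'm \<Rightarrow> bool" where
  "is_cokernel C c f \<longleftrightarrow> c \<in> Arr C \<and> f \<in> Arr C \<and> Dom C c = Cod C f \<and>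
     c \<cdot>\<^bsub>C\<^esub> f = Zero C (Dom C f) (Cod C c) \<and>
     (\<forall>Z. \<forall>h \<in> Hom C (Cod C f) Z. h \<cdot>\<^bsub>C\<^esub> f = Zero C (Dom C f) Z \<longrightarrow>
        (\<exists>!u. u \<in> Hom C (Cod C c) Z \<and> u \<cdot>\<^bsub>C\<^esub> c = h))"

text \<open>\<open>S\<close> is the direct sum of \<open>X\<close> and \<open>Y\<close> with injections \<open>i\<close>, \<open>j\<close> and projections \<open>r\<close>, \<open>s\<close>.\<close>

definition is_biproduct ::
  "('o, 'm, 'r) preadditive_scheme \<Rightarrow> 'o \<Rightarrow> 'o \<Rightarrow> 'o \<Rightarrow> 'm \<Rightarrow> 'm \<Rightarrow> 'm \<Rightarrow> 'm \<Rightarrow> bool" where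
  "is_biproduct C X Y S i j r s \<longleftrightarrow>
     X \<in> Obj C \<and> Y \<in> Obj C \<and> S \<in> Obj C \<and>
     i \<in> Hom C X S \<and> j \<in> Hom C Y S \<and> r \<in> Hom C S X \<and> s \<in> Hom C S Y \<and>
     r \<cdot>\<^bsub>C\<^esub> i = Id C X \<and> s \<cdot>\<^bsub>C\<^esub> j = Id C Y \<and>
     s \<cdot>\<^bsub>C\<^esub> i = Zero C X Y \<and> r \<cdot>\<^bsub>C\<^esub> j = Zero C Y X \<and>
     (i \<cdot>\<^bsub>C\<^esub> r) \<boxplus>\<^bsub>C\<^esub> (j \<cdot>\<^bsub>C\<^esub> s) = Id C S"

definition direct_summand :: "('o, 'm, 'r) preadditive_scheme \<Rightarrow> 'o \<Rightarrow> 'o \<Rightarrow> bool" where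
  "direct_summand C D S \<longleftrightarrow> (\<exists>K i j r s. is_biproduct C D K S i j r s)"

locale abelian_category = category C for C :: "('o, 'm, 'r) preadditive_scheme" (structure) +
  assumes Hom_comm_group: "\<lbrakk>X \<in> Obj C; Y \<in> Obj C\<rbrakk> \<Longrightarrow> comm_group (Hom_group C X Y)"
    and Comp_Add: "\<lbrakk>f \<in> Hom C X Y; g \<in> Hom C X Y; h \<in> Hom C Y Z\<rbrakk>
      \<Longrightarrow> h \<cdot> (f \<boxplus> g) = (h \<cdot> f) \<boxplus> (h \<cdot> g)"
    and Add_Comp: "\<lbrakk>h \<in> Hom C W X; f \<in> Hom C X Y; g \<in> Hom C X Y\<rbrakk>
      \<Longrightarrow> (f \<boxplus> g) \<cdot> h = (f \<cdot> h) \<boxplus> (g \<cdot> h)"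
    and ex_zero_object: "\<exists>Z. zero_object C Z"
    and ex_biproduct: "\<lbrakk>X \<in> Obj C; Y \<in> Obj C\<rbrakk> \<Longrightarrow> \<exists>S i j r s. is_biproduct C X Y S i j r s"
    and ex_kernel: "f \<in> Arr C \<Longrightarrow> \<exists>k. is_kernel C k f"
    and ex_cokernel: "f \<in> Arr C \<Longrightarrow> \<exists>c. is_cokernel C c f"
    and monic_normal: "monic C m \<Longrightarrow> \<exists>f. is_kernel C m f"
    and epic_normal: "epic C e \<Longrightarrow> \<exists>f. is_cokernel C e f"

text \<open>\<open>(E, i, p)\<close> stands for the short exact sequence \<open>0 \<rightarrow> Y \<rightarrow> E \<rightarrow> X \<rightarrow> 0\<close> with maps
  \<open>i : Y \<rightarrow> E\<close> and \<open>p : E \<rightarrow> X\<close>.\<close>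

definition extensions ::
  "('o, 'm, 'r) preadditive_scheme \<Rightarrow> 'o \<Rightarrow> 'o \<Rightarrow> ('o \<times> 'm \<times> 'm) set" where
  "extensions C X Y = {(E, i, p). i \<in> Hom C Y E \<and> p \<in> Hom C E X \<and>
     is_kernel C i p \<and> is_cokernel C p i}"

text \<open>Asking \<open>\<phi>\<close> to be an isomorphism is no restriction, by the five lemma.\<close>

definition ext_equiv ::
  "('o, 'm, 'r) preadditive_scheme \<Rightarrow> 'o \<Rightarrow> 'o \<Rightarrow> (('o \<times> 'm \<times> 'm) \<times> ('o \<times> 'm \<times> 'm)) set" where
  "ext_equiv C X Y = {((E, i, p), (E', i', p')).
     (E, i, p) \<in> extensions C X Y \<and> (E', i', p') \<in> extensions C X Y \<and>
     (\<exists>\<phi> \<in> Hom C E E'. iso_arr C \<phi> \<and> \<phi> \<cdot>\<^bsub>C\<^esub> i = i' \<and> p' \<cdot>\<^bsub>C\<^esub> \<phi> = p)}"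

text \<open>The Baer sum of \<open>(E\<^sub>1, i\<^sub>1, p\<^sub>1)\<close> and \<open>(E\<^sub>2, i\<^sub>2, p\<^sub>2)\<close>: form the pullback
  \<open>G = E\<^sub>1 \<times>\<^sub>X E\<^sub>2\<close> and divide out the antidiagonal copy \<open>d = (i\<^sub>1, - i\<^sub>2)\<close> of \<open>Y\<close>;
  the injection of \<open>Y\<close> into the quotient is induced by \<open>u = (i\<^sub>1, 0)\<close>. It is a relation on
  representatives, since pullbacks and cokernels are determined only up to isomorphism.\<close>

definition is_Baer_sum ::
  "('o, 'm, 'r) preadditive_scheme \<Rightarrow> 'o \<Rightarrow> 'o \<Rightarrow>
     ('o \<times> 'm \<times> 'm) \<Rightarrow> ('o \<times> 'm \<times> 'm) \<Rightarrow> ('o \<times> 'm \<times> 'm) \<Rightarrow> bool" where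
  "is_Baer_sum C X Y = (\<lambda>(E\<^sub>1, i\<^sub>1, p\<^sub>1) (E\<^sub>2, i\<^sub>2, p\<^sub>2) (E, i, p).
     (\<exists>G q\<^sub>1 q\<^sub>2. is_pullback C p\<^sub>1 p\<^sub>2 G q\<^sub>1 q\<^sub>2 \<and>
       (\<exists>d \<in> Hom C Y G. \<exists>u \<in> Hom C Y G. \<exists>c \<in> Hom C G E.
          q\<^sub>1 \<cdot>\<^bsub>C\<^esub> d = i\<^sub>1 \<and> q\<^sub>2 \<cdot>\<^bsub>C\<^esub> d = inv\<^bsub>Hom_group C Y E\<^sub>2\<^esub> i\<^sub>2 \<and>
          q\<^sub>1 \<cdot>\<^bsub>C\<^esub> u = i\<^sub>1 \<and> q\<^sub>2 \<cdot>\<^bsub>C\<^esub> u = Zero C Y E\<^sub>2 \<and>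
          is_cokernel C c d \<and> i = c \<cdot>\<^bsub>C\<^esub> u \<and>
          p \<in> Hom C E X \<and> p \<cdot>\<^bsub>C\<^esub> c = p\<^sub>1 \<cdot>\<^bsub>C\<^esub> q\<^sub>1)))"

text \<open>The neutral element is the class of the split extension
  \<open>0 \<rightarrow> Y \<rightarrow> Y \<oplus> X \<rightarrow> X \<rightarrow> 0\<close>, whose members are the extensions that form, with some
  \<open>j : X \<rightarrow> E\<close> and \<open>r : E \<rightarrow> Y\<close>, a direct sum diagram.\<close>

definition Ext1 ::
  "('o, 'm, 'r) preadditive_scheme \<Rightarrow> 'o \<Rightarrow> 'o \<Rightarrow> ('o \<times> 'm \<times> 'm) set monoid" where
  "Ext1 C X Y = \<lparr>
     carrier = extensions C X Y // ext_equiv C X Y,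
     mult = (\<lambda>A B. {e \<in> extensions C X Y. \<exists>a \<in> A. \<exists>b \<in> B. is_Baer_sum C X Y a b e}),
     one = {(E, i, p) \<in> extensions C X Y. \<exists>j r. is_biproduct C Y X E i j r p}\<rparr>"

end

(* Let \<kappa> : K \<rightarrow> N be the kernel of g; it lifts to the kernel k : K \<rightarrow> P of p. The pushout of
   0 \<rightarrow> K \<rightarrow> N \<rightarrow> T \<rightarrow> 0 along k is an extension of T by P, hence it splits, and its retraction
   restricts to h : N \<rightarrow> P with h \<kappa> = k. Since p h kills \<kappa>, it factors through a map T \<rightarrow> M and is
   therefore 0; so h factors through k, which gives a retraction of \<kappa> and a section s of g.
   Then (1, s f) is a section of p. *)
theory Submission
  imports Defs
begin

section \<open>Arrows, retracts and pullbacks in an arbitrary category\<close>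

lemma Hom_eqs: "x \<in> Hom C X Y \<Longrightarrow> x \<in> Arr C \<and> Dom C x = X \<and> Cod C x = Y"
  by (simp add: Hom_def)

lemma split_epic_iff:
  "p \<in> Hom C P M \<Longrightarrow> split_epic C p \<longleftrightarrow> (\<exists>s \<in> Hom C M P. p \<cdot>\<^bsub>C\<^esub> s = Id C M)"
  by (auto simp: Hom_eqs split_epic_def)

context category
begin

lemma Hom_Obj: "f \<in> Hom C X Y \<Longrightarrow> X \<in> Obj C \<and> Y \<in> Obj C"
  using Dom_in_Obj Cod_in_Obj by (auto simp: Hom_def)

lemma epicD:
  "\<lbrakk>epic C e; e \<in> Hom C X Y; a \<in> Hom C Y Z; b \<in> Hom C Y Z; a \<cdot> e = b \<cdot> e\<rbrakk> \<Longrightarrow> a = b"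
  by (auto simp: epic_def Hom_def)

lemma monicD:
  "\<lbrakk>monic C m; m \<in> Hom C X Y; a \<in> Hom C W X; b \<in> Hom C W X; m \<cdot> a = m \<cdot> b\<rbrakk> \<Longrightarrow> a = b"
  by (auto simp: monic_def Hom_def)

lemma isomorphic_refl: "X \<in> Obj C \<Longrightarrow> isomorphic C X X"
  unfolding isomorphic_def iso_arr_def
  using Id_in_Hom[of X] Comp_Id[OF Id_in_Hom] by (metis Hom_eqs)

text \<open>To lift \<open>h\<close> along \<open>e\<close>, lift \<open>h \<cdot> p\<close> from
  the projective object \<open>P\<close> and precompose the lift with the section
  \<open>s\<close>.\<close>

lemma projective_retract:
  assumes "projective C P" and p: "p \<in> Hom C P M" and s: "s \<in> Hom C M P" and ps: "p \<cdot> s = Id C M"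
  shows "projective C M"
  unfolding projective_def
proof (intro conjI allI impI)
  show "M \<in> Obj C" using Hom_Obj[OF p] by simp
  fix e h assume *: "epic C e \<and> h \<in> Hom C M (Cod C e)"
  then have e: "e \<in> Hom C (Dom C e) (Cod C e)" and h: "h \<in> Hom C M (Cod C e)"
    by (auto simp: epic_def Hom_def)
  obtain l where l: "l \<in> Hom C P (Dom C e)" "e \<cdot> l = h \<cdot> p"
    using assms(1) * Comp_in_Hom[OF p h] unfolding projective_def by blast
  have "e \<cdot> (l \<cdot> s) = h"
    using Comp_assoc[OF s l(1) e] Comp_assoc[OF s p h] l(2) ps Comp_Id[OF h] by simp
  then show "\<exists>l\<in>Hom C M (Dom C e). e \<cdot> l = h"
    using Comp_in_Hom[OF s l(1)] by blast
qed

lemma pullback_factor: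
  assumes "is_pullback C f g P p q" and "f \<in> Hom C M T" and "g \<in> Hom C N T"
    and "a \<in> Hom C W M" and "b \<in> Hom C W N" and "f \<cdot> a = g \<cdot> b"
  obtains u where "u \<in> Hom C W P" "p \<cdot> u = a" "q \<cdot> u = b"
  using assms unfolding is_pullback_def by (metis Hom_eqs)

lemma pullback_Hom:
  assumes "is_pullback C f g P p q" and "f \<in> Hom C M T" and "g \<in> Hom C N T"
  shows "p \<in> Hom C P M" "q \<in> Hom C P N" "f \<cdot> p = g \<cdot> q"
  using assms unfolding is_pullback_def by (metis Hom_eqs)+

text \<open>This is the uniqueness half of the universal property for the cone
  \<open>(p \<cdot> u, q \<cdot> u)\<close>: the two projections are jointly monic.\<close>

lemma pullback_eqI:
  assumes pb: "is_pullback C f g P p q" and fg: "f \<in> Hom C M T" "g \<in> Hom C N T"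
    and u: "u \<in> Hom C W P" and v: "v \<in> Hom C W P"
    and eq: "p \<cdot> u = p \<cdot> v" "q \<cdot> u = q \<cdot> v"
  shows "u = v"
proof -
  note pq = pullback_Hom[OF pb fg]
  have "f \<cdot> (p \<cdot> u) = g \<cdot> (q \<cdot> u)"
    using Comp_assoc[OF u pq(1) fg(1)] Comp_assoc[OF u pq(2) fg(2)] pq(3) by simp
  moreover have "p \<cdot> u \<in> Hom C W (Dom C f)" "q \<cdot> u \<in> Hom C W (Dom C g)"
    using Comp_in_Hom[OF u pq(1)] Comp_in_Hom[OF u pq(2)] fg by (simp_all add: Hom_eqs)
  ultimately have "\<exists>!w. w \<in> Hom C W P \<and> p \<cdot> w = p \<cdot> u \<and> q \<cdot> w = q \<cdot> u"
    using pb unfolding is_pullback_def by blast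
  then show ?thesis using u v eq by auto
qed

lemma pullback_sym: "is_pullback C f g P p q \<Longrightarrow> is_pullback C g f P q p"
  unfolding is_pullback_def by (smt (verit))

end

context abelian_category
begin

section \<open>Arithmetic in the Hom-groups\<close>

lemma Zero_Hom: "\<lbrakk>X \<in> Obj C; Y \<in> Obj C\<rbrakk> \<Longrightarrow> Zero C X Y \<in> Hom C X Y"
  using Hom_comm_group[of X Y] group.is_monoid monoid.one_closed
  unfolding comm_group_def Hom_group_def by fastforce

lemma Add_Hom: "\<lbrakk>a \<in> Hom C X Y; b \<in> Hom C X Y\<rbrakk> \<Longrightarrow> a \<boxplus> b \<in> Hom C X Y"
  using Hom_comm_group[of X Y] Hom_Obj[of a X Y] monoid.m_closed[of "Hom_group C X Y" a b]
  by (simp add: Hom_group_def comm_group_def group_def)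

lemma Add_assoc:
  "\<lbrakk>a \<in> Hom C X Y; b \<in> Hom C X Y; c \<in> Hom C X Y\<rbrakk> \<Longrightarrow> a \<boxplus> b \<boxplus> c = a \<boxplus> (b \<boxplus> c)"
  using Hom_comm_group[of X Y] Hom_Obj[of a X Y] monoid.m_assoc[of "Hom_group C X Y" a b c]
  by (simp add: Hom_group_def comm_group_def group_def)

lemma Add_comm: "\<lbrakk>a \<in> Hom C X Y; b \<in> Hom C X Y\<rbrakk> \<Longrightarrow> a \<boxplus> b = b \<boxplus> a"
  using Hom_comm_group[of X Y] Hom_Obj[of a X Y] comm_monoid.m_comm[of "Hom_group C X Y" a b]
  by (simp add: Hom_group_def comm_group_def)

lemma Zero_Add: "a \<in> Hom C X Y \<Longrightarrow> Zero C X Y \<boxplus> a = a"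
  using Hom_comm_group[of X Y] Hom_Obj[of a X Y] monoid.l_one[of "Hom_group C X Y" a]
  by (simp add: Hom_group_def comm_group_def group_def)

lemma Add_Zero: "a \<in> Hom C X Y \<Longrightarrow> a \<boxplus> Zero C X Y = a"
  using Add_comm Zero_Add Zero_Hom Hom_Obj by metis

text \<open>The Hom-group is read off from the domain and codomain of the arrow, so that negation
  can be written without naming objects.\<close>

definition Neg :: "'m \<Rightarrow> 'm" where
  "Neg a = inv\<^bsub>Hom_group C (Dom C a) (Cod C a)\<^esub> a"

lemma Hom_inv:
  assumes a: "a \<in> Hom C X Y"
  shows "Neg a \<in> Hom C X Y" "a \<boxplus> Neg a = Zero C X Y"
proof -
  interpret H: comm_group "Hom_group C X Y" using Hom_comm_group Hom_Obj[OF a] by simp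
  have neg: "Neg a = inv\<^bsub>Hom_group C X Y\<^esub> a" using a by (simp add: Neg_def Hom_eqs)
  have "a \<in> carrier (Hom_group C X Y)" using a by (simp add: Hom_group_def)
  note H.inv_closed[OF this] H.r_inv[OF this]
  then show "Neg a \<in> Hom C X Y" "a \<boxplus> Neg a = Zero C X Y"
    unfolding neg by (simp_all add: Hom_group_def)
qed

lemmas Neg_Hom = Hom_inv(1) and Add_Neg = Hom_inv(2)

lemma Add_cancel_left:
  assumes a: "a \<in> Hom C X Y" and b: "b \<in> Hom C X Y" and c: "c \<in> Hom C X Y" and eq: "a \<boxplus> b = a \<boxplus> c"
  shows "b = c"
proof -
  have *: "Neg a \<boxplus> a = Zero C X Y" using Add_Neg[OF a] Add_comm[OF a Neg_Hom[OF a]] by simp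
  have "Neg a \<boxplus> (a \<boxplus> b) = Neg a \<boxplus> (a \<boxplus> c)" using eq by simp
  then show ?thesis
    using Add_assoc[OF Neg_Hom[OF a] a b] Add_assoc[OF Neg_Hom[OF a] a c] *
      Zero_Add[OF b] Zero_Add[OF c] by simp
qed

text \<open>With distributivity, uniqueness of inverses gives the rules for moving
  \<open>Neg\<close> out of a composite.\<close>

lemma Neg_unique:
  assumes a: "a \<in> Hom C X Y" and b: "b \<in> Hom C X Y" and "a \<boxplus> b = Zero C X Y"
  shows "b = Neg a"
  using assms Add_cancel_left[OF a b Neg_Hom[OF a]] Add_Neg[OF a] by simp

lemma diff_eq_Zero:
  assumes a: "a \<in> Hom C X Y" and b: "b \<in> Hom C X Y" and "a \<boxplus> Neg b = Zero C X Y"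
  shows "a = b"
  using Add_cancel_left[OF Neg_Hom[OF b] a b] Add_comm[OF a Neg_Hom[OF b]]
    Add_comm[OF b Neg_Hom[OF b]] Add_Neg[OF b] assms(3) by simp

text \<open>Distributivity makes the composite equal to its own double, and cancellation in the
  Hom-group then makes it zero.\<close>

lemma Comp_Zero:
  assumes h: "h \<in> Hom C Y Z" and X: "X \<in> Obj C"
  shows "h \<cdot> Zero C X Y = Zero C X Z"
proof -
  have z: "Zero C X Y \<in> Hom C X Y" using X Hom_Obj[OF h] Zero_Hom by simp
  have hz: "h \<cdot> Zero C X Y \<in> Hom C X Z" by (rule Comp_in_Hom[OF z h])
  have "h \<cdot> Zero C X Y \<boxplus> h \<cdot> Zero C X Y = h \<cdot> Zero C X Y \<boxplus> Zero C X Z"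
    using Comp_Add[OF z z h] Zero_Add[OF z] Add_Zero[OF hz] by simp
  then show ?thesis
    using Add_cancel_left[OF hz hz] Zero_Hom X Hom_Obj[OF h] by blast
qed

lemma Zero_Comp:
  assumes h: "h \<in> Hom C W X" and Y: "Y \<in> Obj C"
  shows "Zero C X Y \<cdot> h = Zero C W Y"
proof -
  have z: "Zero C X Y \<in> Hom C X Y" using Y Hom_Obj[OF h] Zero_Hom by simp
  have hz: "Zero C X Y \<cdot> h \<in> Hom C W Y" by (rule Comp_in_Hom[OF h z])
  have "Zero C X Y \<cdot> h \<boxplus> Zero C X Y \<cdot> h = Zero C X Y \<cdot> h \<boxplus> Zero C W Y"
    using Add_Comp[OF h z z] Zero_Add[OF z] Add_Zero[OF hz] by simp
  then show ?thesis
    using Add_cancel_left[OF hz hz] Zero_Hom Y Hom_Obj[OF h] by blast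
qed

lemma Comp_Neg:
  assumes a: "a \<in> Hom C X Y" and h: "h \<in> Hom C Y Z"
  shows "h \<cdot> Neg a = Neg (h \<cdot> a)"
  by (rule Neg_unique[OF Comp_in_Hom[OF a h] Comp_in_Hom[OF Neg_Hom[OF a] h]])
    (use Comp_Add[OF a Neg_Hom[OF a] h] Add_Neg[OF a] Comp_Zero[OF h] Hom_Obj[OF a] in simp)

lemma Neg_Comp:
  assumes a: "a \<in> Hom C X Y" and h: "h \<in> Hom C W X"
  shows "Neg a \<cdot> h = Neg (a \<cdot> h)"
  by (rule Neg_unique[OF Comp_in_Hom[OF h a] Comp_in_Hom[OF h Neg_Hom[OF a]]])
    (use Add_Comp[OF h a Neg_Hom[OF a]] Add_Neg[OF a] Zero_Comp[OF h] Hom_Obj[OF a] in simp)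

lemma Neg_Zero: "\<lbrakk>X \<in> Obj C; Y \<in> Obj C\<rbrakk> \<Longrightarrow> Neg (Zero C X Y) = Zero C X Y"
  using Zero_Hom Zero_Add Neg_unique by metis

text \<open>Since \<open>r\<close> is a retraction of \<open>i\<close>, the arrow
  \<open>i \<cdot> r\<close> is idempotent; the lemma concerns the complementary idempotent. It will
  be factored through a kernel by the first equation, through a cokernel by the second.\<close>

lemma diff_self_section:
  assumes i: "i \<in> Hom C X Y" and r: "r \<in> Hom C Y X" and ri: "r \<cdot> i = Id C X"
  shows "r \<cdot> (Id C Y \<boxplus> Neg (i \<cdot> r)) = Zero C Y X" "(Id C Y \<boxplus> Neg (i \<cdot> r)) \<cdot> i = Zero C X Y"
proof -
  have Y: "Id C Y \<in> Hom C Y Y" using Id_in_Hom Hom_Obj[OF i] by simp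
  have ir: "i \<cdot> r \<in> Hom C Y Y" by (rule Comp_in_Hom[OF r i])
  show "r \<cdot> (Id C Y \<boxplus> Neg (i \<cdot> r)) = Zero C Y X"
    using Comp_Add[OF Y Neg_Hom[OF ir] r] Comp_Neg[OF ir r] Comp_assoc[OF r i r] ri
      Id_Comp[OF r] Comp_Id[OF r] Add_Neg[OF r] by simp
  show "(Id C Y \<boxplus> Neg (i \<cdot> r)) \<cdot> i = Zero C X Y"
    using Add_Comp[OF i Y Neg_Hom[OF ir]] Neg_Comp[OF ir i] Comp_assoc[OF i r i] ri
      Id_Comp[OF i] Comp_Id[OF i] Add_Neg[OF i] by simp
qed

section \<open>Epics and monics tested against zero\<close>

text \<open>Cancelling \<open>e\<close> from \<open>a \<cdot> e = b \<cdot> e\<close> is the same as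
  showing that the difference of \<open>a\<close> and \<open>b\<close> vanishes.\<close>

lemma epicI:
  assumes e: "e \<in> Hom C X Y"
    and zero: "\<And>Z a. \<lbrakk>a \<in> Hom C Y Z; a \<cdot> e = Zero C X Z\<rbrakk> \<Longrightarrow> a = Zero C Y Z"
  shows "epic C e"
  unfolding epic_def
proof (intro conjI allI ballI impI)
  show "e \<in> Arr C" using e by (simp add: Hom_def)
  fix Z a b assume ab: "a \<in> Hom C (Cod C e) Z" "b \<in> Hom C (Cod C e) Z" and eq: "a \<cdot> e = b \<cdot> e"
  have a: "a \<in> Hom C Y Z" and b: "b \<in> Hom C Y Z" using ab e by (simp_all add: Hom_eqs)
  have "(a \<boxplus> Neg b) \<cdot> e = Zero C X Z"
    using Add_Comp[OF e a Neg_Hom[OF b]] Neg_Comp[OF b e] eq Add_Neg[OF Comp_in_Hom[OF e b]] by simp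
  then show "a = b" using zero Add_Hom[OF a Neg_Hom[OF b]] diff_eq_Zero[OF a b] by blast
qed

lemma monicI:
  assumes m: "m \<in> Hom C X Y"
    and zero: "\<And>W a. \<lbrakk>a \<in> Hom C W X; m \<cdot> a = Zero C W Y\<rbrakk> \<Longrightarrow> a = Zero C W X"
  shows "monic C m"
  unfolding monic_def
proof (intro conjI allI ballI impI)
  show "m \<in> Arr C" using m by (simp add: Hom_def)
  fix W a b assume ab: "a \<in> Hom C W (Dom C m)" "b \<in> Hom C W (Dom C m)" and eq: "m \<cdot> a = m \<cdot> b"
  have a: "a \<in> Hom C W X" and b: "b \<in> Hom C W X" using ab m by (simp_all add: Hom_eqs)
  have "m \<cdot> (a \<boxplus> Neg b) = Zero C W Y"
    using Comp_Add[OF a Neg_Hom[OF b] m] Comp_Neg[OF b m] eq Add_Neg[OF Comp_in_Hom[OF b m]] by simp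
  then show "a = b" using zero Add_Hom[OF a Neg_Hom[OF b]] diff_eq_Zero[OF a b] by blast
qed

lemma epic_Zero:
  assumes "epic C e" and e: "e \<in> Hom C X Y" and a: "a \<in> Hom C Y Z" and "a \<cdot> e = Zero C X Z"
  shows "a = Zero C Y Z"
  using epicD[OF assms(1) e a] Zero_Hom Zero_Comp[OF e] assms(4) Hom_Obj[OF a] by simp

lemma monic_Zero:
  assumes "monic C m" and m: "m \<in> Hom C X Y" and a: "a \<in> Hom C W X" and "m \<cdot> a = Zero C W Y"
  shows "a = Zero C W X"
  using monicD[OF assms(1) m a] Zero_Hom Comp_Zero[OF m] assms(4) Hom_Obj[OF a] by simp

section \<open>Kernels, cokernels and normality\<close>

text \<open>Monicity of \<open>k\<close> supplies uniqueness of the factorisation, so that only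
  existence has to be checked.\<close>

lemma kernelI:
  assumes k: "k \<in> Hom C K X" and f: "f \<in> Hom C X Y" and "monic C k" and "f \<cdot> k = Zero C K Y"
    and "\<And>W h. \<lbrakk>h \<in> Hom C W X; f \<cdot> h = Zero C W Y\<rbrakk> \<Longrightarrow> \<exists>u \<in> Hom C W K. k \<cdot> u = h"
  shows "is_kernel C k f"
proof -
  have "\<exists>!u. u \<in> Hom C W K \<and> k \<cdot> u = h" if "h \<in> Hom C W X" "f \<cdot> h = Zero C W Y" for W h
    using assms(5)[OF that] monicD[OF assms(3) k] by (metis (no_types, lifting))
  then show ?thesis using assms by (auto simp: is_kernel_def Hom_eqs)
qed

lemma cokernelI:
  assumes c: "c \<in> Hom C Y Q" and f: "f \<in> Hom C X Y" and "epic C c" and "c \<cdot> f = Zero C X Q"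
    and "\<And>Z h. \<lbrakk>h \<in> Hom C Y Z; h \<cdot> f = Zero C X Z\<rbrakk> \<Longrightarrow> \<exists>u \<in> Hom C Q Z. u \<cdot> c = h"
  shows "is_cokernel C c f"
proof -
  have "\<exists>!u. u \<in> Hom C Q Z \<and> u \<cdot> c = h" if "h \<in> Hom C Y Z" "h \<cdot> f = Zero C X Z" for Z h
    using assms(5)[OF that] epicD[OF assms(3) c] by (metis (no_types, lifting))
  then show ?thesis using assms by (auto simp: is_cokernel_def Hom_eqs)
qed

lemma kernel_Zero: "\<lbrakk>is_kernel C k f; k \<in> Hom C K X; f \<in> Hom C X Y\<rbrakk> \<Longrightarrow> f \<cdot> k = Zero C K Y"
  by (auto simp: is_kernel_def Hom_eqs)

lemma kernel_factor:
  assumes "is_kernel C k f" "k \<in> Hom C K X" "f \<in> Hom C X Y" "h \<in> Hom C W X" "f \<cdot> h = Zero C W Y"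
  obtains u where "u \<in> Hom C W K" "k \<cdot> u = h"
  using assms unfolding is_kernel_def by (metis Hom_eqs)

lemma cokernel_Zero: "\<lbrakk>is_cokernel C c f; c \<in> Hom C Y Q; f \<in> Hom C X Y\<rbrakk> \<Longrightarrow> c \<cdot> f = Zero C X Q"
  by (auto simp: is_cokernel_def Hom_eqs)

lemma cokernel_factor:
  assumes "is_cokernel C c f" "c \<in> Hom C Y Q" "f \<in> Hom C X Y" "h \<in> Hom C Y Z" "h \<cdot> f = Zero C X Z"
  obtains u where "u \<in> Hom C Q Z" "u \<cdot> c = h"
  using assms unfolding is_cokernel_def by (metis Hom_eqs)

text \<open>If \<open>k \<cdot> a\<close> is zero, then \<open>a\<close> and the zero arrow are both
  factorisations of zero through \<open>k\<close>, hence equal.\<close>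

lemma kernel_monic:
  assumes "is_kernel C k f" and k: "k \<in> Hom C K X" and f: "f \<in> Hom C X Y"
  shows "monic C k"
proof (rule monicI[OF k])
  fix W a assume a: "a \<in> Hom C W K" and ka: "k \<cdot> a = Zero C W X"
  have W: "W \<in> Obj C" "K \<in> Obj C" "X \<in> Obj C" using Hom_Obj a k by blast+
  have "\<exists>!u. u \<in> Hom C W K \<and> k \<cdot> u = Zero C W X"
    using assms(1) Zero_Hom[OF W(1,3)] Comp_Zero[OF f W(1)] k f
    unfolding is_kernel_def by (metis Hom_eqs)
  then show "a = Zero C W K" using a ka Zero_Hom[OF W(1,2)] Comp_Zero[OF k W(1)] by auto
qed

lemma cokernel_epic:
  assumes "is_cokernel C c f" and c: "c \<in> Hom C Y Q" and f: "f \<in> Hom C X Y"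
  shows "epic C c"
proof (rule epicI[OF c])
  fix Z a assume a: "a \<in> Hom C Q Z" and ac: "a \<cdot> c = Zero C Y Z"
  have Z: "Z \<in> Obj C" "Q \<in> Obj C" "Y \<in> Obj C" using Hom_Obj a c by blast+
  have "\<exists>!u. u \<in> Hom C Q Z \<and> u \<cdot> c = Zero C Y Z"
    using assms(1) Zero_Hom[OF Z(3,1)] Zero_Comp[OF f Z(1)] c f
    unfolding is_cokernel_def by (metis Hom_eqs)
  then show "a = Zero C Q Z" using a ac Zero_Hom[OF Z(2,1)] Zero_Comp[OF c Z(1)] by auto
qed

lemma obtain_kernel:
  assumes f: "f \<in> Hom C X Y"
  obtains K k where "k \<in> Hom C K X" "is_kernel C k f"
proof -
  obtain k where k: "is_kernel C k f" using ex_kernel f Hom_eqs by metis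
  then have "k \<in> Hom C (Dom C k) X" using f by (auto simp: is_kernel_def Hom_def)
  with k show ?thesis using that by blast
qed

lemma obtain_cokernel:
  assumes f: "f \<in> Hom C X Y"
  obtains Q c where "c \<in> Hom C Y Q" "is_cokernel C c f"
proof -
  obtain c where c: "is_cokernel C c f" using ex_cokernel f Hom_eqs by metis
  then have "c \<in> Hom C Y (Cod C c)" using f by (auto simp: is_cokernel_def Hom_def)
  with c show ?thesis using that by blast
qed

text \<open>Normality makes \<open>e\<close> the cokernel of some \<open>t\<close>. As
  \<open>e\<close> kills \<open>t\<close>, this \<open>t\<close> factors through \<open>k\<close>;
  so whatever kills \<open>k\<close> also kills \<open>t\<close> and factors through
  \<open>e\<close>.\<close>

lemma epic_is_cokernel_of_kernel:
  assumes "epic C e" and e: "e \<in> Hom C X Y" and k: "k \<in> Hom C K X" and "is_kernel C k e"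
  shows "is_cokernel C e k"
proof (rule cokernelI[OF e k assms(1) kernel_Zero[OF assms(4) k e]])
  fix Z h assume h: "h \<in> Hom C X Z" and hk: "h \<cdot> k = Zero C K Z"
  obtain t where t: "is_cokernel C e t" using epic_normal[OF assms(1)] by blast
  define W where "W = Dom C t"
  have tH: "t \<in> Hom C W X" using t e by (auto simp: is_cokernel_def W_def Hom_def)
  obtain u where u: "u \<in> Hom C W K" "k \<cdot> u = t"
    using kernel_factor[OF assms(4) k e tH cokernel_Zero[OF t e tH]] .
  have "h \<cdot> t = Zero C W Z"
    using Comp_assoc[OF u(1) k h] u(2) hk Zero_Comp[OF u(1)] Hom_Obj[OF h] by simp
  then show "\<exists>u\<in>Hom C Y Z. u \<cdot> e = h" using cokernel_factor[OF t e tH h] by metis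
qed

text \<open>Dually, \<open>m\<close> is the kernel of some \<open>t\<close>, and \<open>t\<close>
  factors through \<open>c\<close> because it kills \<open>m\<close>; so \<open>t\<close> kills
  whatever \<open>c\<close> kills.\<close>

lemma monic_is_kernel_of_cokernel:
  assumes "monic C m" and m: "m \<in> Hom C X Y" and c: "c \<in> Hom C Y Q" and "is_cokernel C c m"
  shows "is_kernel C m c"
proof (rule kernelI[OF m c assms(1) cokernel_Zero[OF assms(4) c m]])
  fix W h assume h: "h \<in> Hom C W Y" and ch: "c \<cdot> h = Zero C W Q"
  obtain t where t: "is_kernel C m t" using monic_normal[OF assms(1)] by blast
  define Z where "Z = Cod C t"
  have tH: "t \<in> Hom C Y Z" using t m by (auto simp: is_kernel_def Z_def Hom_def)
  obtain u where u: "u \<in> Hom C Q Z" "u \<cdot> c = t"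
    using cokernel_factor[OF assms(4) c m tH kernel_Zero[OF t m tH]] .
  have "t \<cdot> h = Zero C W Z"
    using Comp_assoc[OF h c u(1)] u(2) ch Comp_Zero[OF u(1)] Hom_Obj[OF h] by simp
  then show "\<exists>u\<in>Hom C W X. m \<cdot> u = h" using kernel_factor[OF t m tH h] by metis
qed

section \<open>Direct sums from sections\<close>

lemma biproduct_Hom:
  assumes "is_biproduct C X Y S i j r s"
  shows "i \<in> Hom C X S" "j \<in> Hom C Y S" "r \<in> Hom C S X" "s \<in> Hom C S Y"
    "r \<cdot> i = Id C X" "s \<cdot> j = Id C Y" "s \<cdot> i = Zero C X Y" "r \<cdot> j = Zero C Y X"
    "(i \<cdot> r) \<boxplus> (j \<cdot> s) = Id C S"
  using assms by (simp_all add: is_biproduct_def)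

text \<open>The complement of the idempotent \<open>s \<cdot> p\<close> is killed by
  \<open>p\<close>, so it factors through the kernel \<open>k\<close>; the factor \<open>t\<close>
  is the missing projection onto \<open>K\<close>.\<close>

lemma section_biproduct:
  assumes p: "p \<in> Hom C P M" and s: "s \<in> Hom C M P" and ps: "p \<cdot> s = Id C M"
    and k: "k \<in> Hom C K P" and ker: "is_kernel C k p"
  obtains t where "is_biproduct C M K P s k p t"
proof -
  have P: "P \<in> Obj C" and M: "M \<in> Obj C" and K: "K \<in> Obj C" using Hom_Obj p k by blast+
  note IP = Id_in_Hom[OF P]
  have sp: "s \<cdot> p \<in> Hom C P P" by (rule Comp_in_Hom[OF p s])
  define e where "e = Id C P \<boxplus> Neg (s \<cdot> p)"
  have e: "e \<in> Hom C P P" unfolding e_def by (rule Add_Hom[OF IP Neg_Hom[OF sp]])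
  note pe = diff_self_section[OF s p ps, folded e_def]
  obtain t where t: "t \<in> Hom C P K" "k \<cdot> t = e" using kernel_factor[OF ker k p e pe(1)] .
  note mk = kernel_monic[OF ker k p]
  note pk = kernel_Zero[OF ker k p]
  have ts: "t \<cdot> s = Zero C M K"
    using monic_Zero[OF mk k Comp_in_Hom[OF s t(1)]] Comp_assoc[OF s t(1) k] t(2) pe(2) by simp
  \<comment> \<open>The subtracted term vanishes on \<open>k\<close> because
    \<open>p \<cdot> k\<close> is zero.\<close>
  have "e \<cdot> k = k"
    unfolding e_def
    using Add_Comp[OF k IP Neg_Hom[OF sp]] Neg_Comp[OF sp k] Comp_assoc[OF k p s] pk
      Comp_Zero[OF s K] Neg_Zero[OF K P] Id_Comp[OF k] Add_Zero[OF k] by simp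
  then have "t \<cdot> k = Id C K"
    using monicD[OF mk k Comp_in_Hom[OF k t(1)] Id_in_Hom[OF K]] Comp_assoc[OF k t(1) k] t(2)
      Comp_Id[OF k] by simp
  moreover have "s \<cdot> p \<boxplus> k \<cdot> t = Id C P"
    unfolding t(2) e_def
    using Add_comm[OF sp Add_Hom[OF IP Neg_Hom[OF sp]]] Add_assoc[OF IP Neg_Hom[OF sp] sp]
      Add_comm[OF sp Neg_Hom[OF sp]] Add_Neg[OF sp] Add_Zero[OF IP] by simp
  ultimately have "is_biproduct C M K P s k p t"
    using P M K p s k t(1) ps ts pk by (simp add: is_biproduct_def)
  then show ?thesis by (rule that)
qed

section \<open>Pullbacks of epics and their kernels\<close>

text \<open>\<open>P\<close> is the kernel of the difference \<open>M \<oplus> N \<rightarrow> T\<close> of \<open>f\<close> and \<open>g\<close>, which is epic because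
  \<open>f\<close> is, and hence is the cokernel of the inclusion of \<open>P\<close>.\<close>

lemma pullback_epic:
  assumes pb: "is_pullback C f g P p q" and f: "f \<in> Hom C M T" and g: "g \<in> Hom C N T"
    and "epic C f" and "epic C g"
  shows "epic C p"
proof -
  note pq = pullback_Hom[OF pb f g]
  have M: "M \<in> Obj C" and N: "N \<in> Obj C" and T: "T \<in> Obj C" using Hom_Obj f g by blast+
  obtain S i j r s where "is_biproduct C M N S i j r s" using ex_biproduct[OF M N] by blast
  note b = biproduct_Hom[OF this]
  have fr: "f \<cdot> r \<in> Hom C S T" and gs: "g \<cdot> s \<in> Hom C S T" using Comp_in_Hom b f g by blast+
  define \<phi> where "\<phi> = f \<cdot> r \<boxplus> Neg (g \<cdot> s)"
  have \<phi>: "\<phi> \<in> Hom C S T" unfolding \<phi>_def by (rule Add_Hom[OF fr Neg_Hom[OF gs]])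
  have \<phi>i: "\<phi> \<cdot> i = f"
    unfolding \<phi>_def
    using Add_Comp[OF b(1) fr Neg_Hom[OF gs]] Neg_Comp[OF gs b(1)] Comp_assoc[OF b(1) b(3) f]
      Comp_assoc[OF b(1) b(4) g] b(5,7) Comp_Zero[OF g M] Neg_Zero[OF M T] Comp_Id[OF f]
      Add_Zero[OF f] by simp
  have \<phi>j: "\<phi> \<cdot> j = Neg g"
    unfolding \<phi>_def
    using Add_Comp[OF b(2) fr Neg_Hom[OF gs]] Neg_Comp[OF gs b(2)] Comp_assoc[OF b(2) b(3) f]
      Comp_assoc[OF b(2) b(4) g] b(6,8) Comp_Zero[OF f N] Comp_Id[OF g]
      Zero_Add[OF Neg_Hom[OF g]] by simp
  have e\<phi>: "epic C \<phi>"
  proof (rule epicI[OF \<phi>])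
    fix Z a assume a: "a \<in> Hom C T Z" and "a \<cdot> \<phi> = Zero C S Z"
    then have "a \<cdot> f = Zero C M Z"
      using Comp_assoc[OF b(1) \<phi> a] \<phi>i Zero_Comp[OF b(1)] Hom_Obj[OF a] by simp
    then show "a = Zero C T Z" by (rule epic_Zero[OF assms(4) f a])
  qed
  obtain K k where k: "k \<in> Hom C K S" "is_kernel C k \<phi>" using obtain_kernel[OF \<phi>] .
  note cok = epic_is_cokernel_of_kernel[OF e\<phi> \<phi> k]
  have rk: "r \<cdot> k \<in> Hom C K M" and sk: "s \<cdot> k \<in> Hom C K N" using Comp_in_Hom b k by blast+
  \<comment> \<open>Because \<open>\<phi>\<close> kills \<open>k\<close>, the two components of
    \<open>k\<close> form a cone over \<open>f\<close> and \<open>g\<close>. The induced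
    \<open>u\<close> shows that any arrow killing \<open>p\<close> also kills
    \<open>r \<cdot> k\<close>.\<close>
  have "f \<cdot> (r \<cdot> k) = g \<cdot> (s \<cdot> k)"
    using diff_eq_Zero[OF Comp_in_Hom[OF rk f] Comp_in_Hom[OF sk g]] kernel_Zero[OF k(2,1) \<phi>]
      Add_Comp[OF k(1) fr Neg_Hom[OF gs]] Neg_Comp[OF gs k(1)] Comp_assoc[OF k(1) b(3) f]
      Comp_assoc[OF k(1) b(4) g] by (simp add: \<phi>_def)
  then obtain u where u: "u \<in> Hom C K P" "p \<cdot> u = r \<cdot> k" "q \<cdot> u = s \<cdot> k"
    by (rule pullback_factor[OF pb f g rk sk])
  show ?thesis
  proof (rule epicI[OF pq(1)])
    fix Z a assume a: "a \<in> Hom C M Z" and ap: "a \<cdot> p = Zero C P Z"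
    have Z: "Z \<in> Obj C" using Hom_Obj[OF a] by simp
    have ar: "a \<cdot> r \<in> Hom C S Z" by (rule Comp_in_Hom[OF b(3) a])
    \<comment> \<open>Since \<open>a \<cdot> r\<close> kills \<open>k\<close>, it has the form
      \<open>v \<cdot> \<phi>\<close>. Restricting to \<open>N\<close> along \<open>j\<close> gives
      \<open>v \<cdot> g = 0\<close>, hence \<open>v = 0\<close> as \<open>g\<close> is epic;
      restricting to \<open>M\<close> along \<open>i\<close> then gives
      \<open>a = 0\<close>.\<close>
    have "(a \<cdot> r) \<cdot> k = Zero C K Z"
      using Comp_assoc[OF k(1) b(3) a] Comp_assoc[OF u(1) pq(1) a] u(2) ap Zero_Comp[OF u(1) Z]
      by simp
    then obtain v where v: "v \<in> Hom C T Z" "v \<cdot> \<phi> = a \<cdot> r"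
      by (rule cokernel_factor[OF cok \<phi> k(1) ar])
    have "v \<cdot> Neg g = Zero C N Z"
      using Comp_assoc[OF b(2) \<phi> v(1)] Comp_assoc[OF b(2) b(3) a] v(2) \<phi>j b(8) Comp_Zero[OF a N]
      by simp
    then have "v \<cdot> g = Zero C N Z"
      using Comp_Neg[OF g v(1)] Comp_in_Hom[OF g v(1)] Add_Neg Add_Zero by metis
    then have "v = Zero C T Z" by (rule epic_Zero[OF assms(5) g v(1)])
    then have "a \<cdot> r = Zero C S Z" using v(2) Zero_Comp[OF \<phi> Z] by simp
    then show "a = Zero C M Z"
      using Comp_assoc[OF b(1) b(3) a] b(5) Comp_Id[OF a] Zero_Comp[OF b(1) Z] by simp
  qed
qed

text \<open>The arrow \<open>k\<close> is induced by the cone \<open>(0, \<kappa>)\<close>. An arrow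
  killed by \<open>p\<close> has its \<open>q\<close>-component killed by \<open>g\<close>, so that
  component comes from \<open>K\<close>.\<close>

lemma pullback_kernel:
  assumes pb: "is_pullback C f g P p q" and f: "f \<in> Hom C M T" and g: "g \<in> Hom C N T"
    and \<kappa>: "\<kappa> \<in> Hom C K N" and ker: "is_kernel C \<kappa> g"
  obtains k where "k \<in> Hom C K P" "is_kernel C k p" "q \<cdot> k = \<kappa>"
proof -
  note pq = pullback_Hom[OF pb f g]
  have M: "M \<in> Obj C" and K: "K \<in> Obj C" using Hom_Obj f \<kappa> by blast+
  have "f \<cdot> Zero C K M = g \<cdot> \<kappa>" using Comp_Zero[OF f K] kernel_Zero[OF ker \<kappa> g] by simp
  then obtain k where k: "k \<in> Hom C K P" "p \<cdot> k = Zero C K M" "q \<cdot> k = \<kappa>"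
    by (rule pullback_factor[OF pb f g Zero_Hom[OF K M] \<kappa>])
  have "is_kernel C k p"
  proof (rule kernelI[OF k(1) pq(1) _ k(2)])
    show "monic C k"
    proof (rule monicI[OF k(1)])
      fix W a assume a: "a \<in> Hom C W K" and "k \<cdot> a = Zero C W P"
      then have "\<kappa> \<cdot> a = Zero C W N"
        using Comp_assoc[OF a k(1) pq(2)] k(3) Comp_Zero[OF pq(2)] Hom_Obj[OF a] by simp
      then show "a = Zero C W K" by (rule monic_Zero[OF kernel_monic[OF ker \<kappa> g] \<kappa> a])
    qed
  next
    fix W h assume h: "h \<in> Hom C W P" and ph: "p \<cdot> h = Zero C W M"
    have W: "W \<in> Obj C" using Hom_Obj[OF h] by simp
    have "g \<cdot> (q \<cdot> h) = Zero C W T"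
      using Comp_assoc[OF h pq(1) f] Comp_assoc[OF h pq(2) g] pq(3) ph Comp_Zero[OF f W] by simp
    then obtain u where u: "u \<in> Hom C W K" "\<kappa> \<cdot> u = q \<cdot> h"
      by (rule kernel_factor[OF ker \<kappa> g Comp_in_Hom[OF h pq(2)]])
    have "k \<cdot> u = h"
      by (rule pullback_eqI[OF pb f g Comp_in_Hom[OF u(1) k(1)] h])
        (use Comp_assoc[OF u(1) k(1) pq(1)] Comp_assoc[OF u(1) k(1) pq(2)] k(2,3) u(2) ph
          Zero_Comp[OF u(1) M] in simp_all)
    then show "\<exists>u\<in>Hom C W K. k \<cdot> u = h" using u(1) by blast
  qed
  then show ?thesis using k that by blast
qed

section \<open>Pushing a short exact sequence out along an arrow\<close>

text \<open>The extension is the cokernel of \<open>(\<kappa>, - k) : K \<rightarrow> N \<oplus> P\<close>.\<close>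

lemma pushout_extension:
  assumes g: "g \<in> Hom C N T" and "epic C g" and \<kappa>: "\<kappa> \<in> Hom C K N" and ker: "is_kernel C \<kappa> g"
    and k: "k \<in> Hom C K P"
  obtains E i t n where "(E, i, t) \<in> extensions C T P" "n \<in> Hom C N E" "n \<cdot> \<kappa> = i \<cdot> k"
proof -
  have N: "N \<in> Obj C" and P: "P \<in> Obj C" and T: "T \<in> Obj C" and K: "K \<in> Obj C"
    using Hom_Obj g k by blast+
  note m\<kappa> = kernel_monic[OF ker \<kappa> g]
  obtain S i j r s where "is_biproduct C N P S i j r s" using ex_biproduct[OF N P] by blast
  note b = biproduct_Hom[OF this]
  have i\<kappa>: "i \<cdot> \<kappa> \<in> Hom C K S" and jk: "j \<cdot> k \<in> Hom C K S" using Comp_in_Hom b \<kappa> k by blast+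
  define d where "d = i \<cdot> \<kappa> \<boxplus> Neg (j \<cdot> k)"
  have d: "d \<in> Hom C K S" unfolding d_def by (rule Add_Hom[OF i\<kappa> Neg_Hom[OF jk]])
  have rd: "r \<cdot> d = \<kappa>"
    unfolding d_def
    using Comp_Add[OF i\<kappa> Neg_Hom[OF jk] b(3)] Comp_Neg[OF jk b(3)] Comp_assoc[OF \<kappa> b(1) b(3)]
      Comp_assoc[OF k b(2) b(3)] b(5,8) Id_Comp[OF \<kappa>] Zero_Comp[OF k N] Neg_Zero[OF K N]
      Add_Zero[OF \<kappa>] by simp
  have md: "monic C d"
  proof (rule monicI[OF d])
    fix W a assume a: "a \<in> Hom C W K" and "d \<cdot> a = Zero C W S"
    then have "\<kappa> \<cdot> a = Zero C W N"
      using Comp_assoc[OF a d b(3)] rd Comp_Zero[OF b(3)] Hom_Obj[OF a] by simp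
    then show "a = Zero C W K" by (rule monic_Zero[OF m\<kappa> \<kappa> a])
  qed
  obtain E c where c: "c \<in> Hom C S E" "is_cokernel C c d" using obtain_cokernel[OF d] .
  have E: "E \<in> Obj C" using Hom_Obj[OF c(1)] by simp
  note ec = cokernel_epic[OF c(2,1) d]
  \<comment> \<open>Exactness at \<open>S\<close>: an arrow killed by \<open>c\<close> comes from
    \<open>K\<close>. This is what makes \<open>c \<cdot> j\<close> monic below.\<close>
  note kd = monic_is_kernel_of_cokernel[OF md d c]
  have ci: "c \<cdot> i \<in> Hom C N E" and cj: "c \<cdot> j \<in> Hom C P E" using Comp_in_Hom b c by blast+
  \<comment> \<open>The sign in \<open>d\<close> turns \<open>c \<cdot> d = 0\<close> into
    commutativity of the pushout square with legs \<open>c \<cdot> i\<close> and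
    \<open>c \<cdot> j\<close>.\<close>
  have n\<kappa>: "(c \<cdot> i) \<cdot> \<kappa> = (c \<cdot> j) \<cdot> k"
    using diff_eq_Zero[OF Comp_in_Hom[OF i\<kappa> c(1)] Comp_in_Hom[OF jk c(1)]]
      cokernel_Zero[OF c(2,1) d] Comp_Add[OF i\<kappa> Neg_Hom[OF jk] c(1)] Comp_Neg[OF jk c(1)]
      Comp_assoc[OF \<kappa> b(1) c(1)] Comp_assoc[OF k b(2) c(1)] by (simp add: d_def)
  have gr: "g \<cdot> r \<in> Hom C S T" by (rule Comp_in_Hom[OF b(3) g])
  \<comment> \<open>On the direct sum, \<open>g \<cdot> r\<close> is \<open>g\<close> on
    \<open>N\<close> and zero on \<open>P\<close>; it descends to the projection \<open>t\<close> of
    the new extension.\<close>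
  have "(g \<cdot> r) \<cdot> d = Zero C K T"
    using Comp_assoc[OF d b(3) g] rd kernel_Zero[OF ker \<kappa> g] by simp
  then obtain t where t: "t \<in> Hom C E T" "t \<cdot> c = g \<cdot> r"
    by (rule cokernel_factor[OF c(2,1) d gr])
  have tcj: "t \<cdot> (c \<cdot> j) = Zero C P T"
    using Comp_assoc[OF b(2) c(1) t(1)] Comp_assoc[OF b(2) b(3) g] t(2) b(8) Comp_Zero[OF g P] by simp
  have tci: "t \<cdot> (c \<cdot> i) = g"
    using Comp_assoc[OF b(1) c(1) t(1)] Comp_assoc[OF b(1) b(3) g] t(2) b(5) Comp_Id[OF g] by simp
  have et: "epic C t"
  proof (rule epicI[OF t(1)])
    fix Z a assume a: "a \<in> Hom C T Z" and "a \<cdot> t = Zero C E Z"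
    then have "a \<cdot> g = Zero C N Z"
      using Comp_assoc[OF ci t(1) a] tci Zero_Comp[OF ci] Hom_Obj[OF a] by simp
    then show "a = Zero C T Z" by (rule epic_Zero[OF assms(2) g a])
  qed
  have mcj: "monic C (c \<cdot> j)"
  proof (rule monicI[OF cj])
    fix W a assume a: "a \<in> Hom C W P" and cja: "(c \<cdot> j) \<cdot> a = Zero C W E"
    have W: "W \<in> Obj C" using Hom_Obj[OF a] by simp
    \<comment> \<open>Now \<open>j \<cdot> a\<close> equals \<open>d \<cdot> v\<close> for some
      \<open>v\<close>. Its \<open>N\<close>-component is zero on one side and
      \<open>\<kappa> \<cdot> v\<close> on the other, so \<open>v\<close>, and with it
      \<open>a\<close>, vanishes.\<close>
    have "c \<cdot> (j \<cdot> a) = Zero C W E" using cja Comp_assoc[OF a b(2) c(1)] by simp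
    then obtain v where v: "v \<in> Hom C W K" "d \<cdot> v = j \<cdot> a"
      by (rule kernel_factor[OF kd d c(1) Comp_in_Hom[OF a b(2)]])
    have "\<kappa> \<cdot> v = Zero C W N"
      using Comp_assoc[OF v(1) d b(3)] Comp_assoc[OF a b(2) b(3)] v(2) rd b(8) Zero_Comp[OF a N]
      by simp
    then have "v = Zero C W K" by (rule monic_Zero[OF m\<kappa> \<kappa> v(1)])
    then have "j \<cdot> a = Zero C W S" using v(2) Comp_Zero[OF d W] by simp
    then show "a = Zero C W P"
      using Comp_assoc[OF a b(2) b(4)] b(6) Id_Comp[OF a] Comp_Zero[OF b(4) W] by simp
  qed
  have cok: "is_cokernel C t (c \<cdot> j)"
  proof (rule cokernelI[OF t(1) cj et tcj])
    fix Z h assume h: "h \<in> Hom C E Z" and hcj: "h \<cdot> (c \<cdot> j) = Zero C P Z"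
    have Z: "Z \<in> Obj C" using Hom_Obj[OF h] by simp
    have hci: "h \<cdot> (c \<cdot> i) \<in> Hom C N Z" by (rule Comp_in_Hom[OF ci h])
    \<comment> \<open>On \<open>N\<close>, the arrow \<open>h\<close> kills \<open>\<kappa>\<close>
      because it kills the image of \<open>P\<close>; so it factors through \<open>g\<close>, the
      cokernel of \<open>\<kappa>\<close>. The factor \<open>u\<close> is the one required for
      \<open>t\<close>.\<close>
    have "(h \<cdot> (c \<cdot> i)) \<cdot> \<kappa> = Zero C K Z"
      using Comp_assoc[OF \<kappa> ci h] n\<kappa> Comp_assoc[OF k cj h] hcj Zero_Comp[OF k Z] by simp
    then obtain u where u: "u \<in> Hom C T Z" "u \<cdot> g = h \<cdot> (c \<cdot> i)"
      by (rule cokernel_factor[OF epic_is_cokernel_of_kernel[OF assms(2) g \<kappa> ker] g \<kappa> hci])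
    have hc: "h \<cdot> c \<in> Hom C S Z" by (rule Comp_in_Hom[OF c(1) h])
    have ir: "i \<cdot> r \<in> Hom C S S" and js: "j \<cdot> s \<in> Hom C S S" using Comp_in_Hom b by blast+
    \<comment> \<open>The equation \<open>h = u \<cdot> t\<close> is checked after the epic
      \<open>c\<close>, by splitting \<open>S\<close> into its two summands.\<close>
    have "h \<cdot> c = (h \<cdot> c) \<cdot> (i \<cdot> r) \<boxplus> (h \<cdot> c) \<cdot> (j \<cdot> s)"
      using Comp_Add[OF ir js hc] b(9) Comp_Id[OF hc] by simp
    also have "(h \<cdot> c) \<cdot> (j \<cdot> s) = Zero C S Z"
      using Comp_assoc[OF b(4) b(2) hc] Comp_assoc[OF b(2) c(1) h] hcj Zero_Comp[OF b(4) Z] by simp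
    also have "(h \<cdot> c) \<cdot> (i \<cdot> r) = u \<cdot> (t \<cdot> c)"
      using Comp_assoc[OF b(3) b(1) hc] Comp_assoc[OF b(1) c(1) h] u(2) t(2) Comp_assoc[OF b(3) g u(1)]
      by simp
    also have "u \<cdot> (t \<cdot> c) \<boxplus> Zero C S Z = (u \<cdot> t) \<cdot> c"
      using Add_Zero[OF Comp_in_Hom[OF Comp_in_Hom[OF c(1) t(1)] u(1)]] Comp_assoc[OF c(1) t(1) u(1)]
      by simp
    finally have "h = u \<cdot> t" by (rule epicD[OF ec c(1) h Comp_in_Hom[OF t(1) u(1)]])
    then show "\<exists>u\<in>Hom C T Z. u \<cdot> t = h" using u(1) by blast
  qed
  have "(E, c \<cdot> j, t) \<in> extensions C T P"
    using cj t(1) cok monic_is_kernel_of_cokernel[OF mcj cj t(1) cok] by (simp add: extensions_def)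
  then show ?thesis using ci n\<kappa> that by blast
qed

section \<open>From vanishing of Hom and Ext to a section\<close>

text \<open>The class of the extension can only be the neutral one, whose members are direct sum
  diagrams; the projection onto \<open>Y\<close> is the retraction.\<close>

lemma extension_splits:
  assumes "carrier (Ext1 C X Y) = {\<one>\<^bsub>Ext1 C X Y\<^esub>}" and x: "(E, i, p) \<in> extensions C X Y"
  obtains r where "r \<in> Hom C E Y" "r \<cdot> i = Id C Y"
proof -
  have E: "E \<in> Obj C" using x Hom_Obj by (auto simp: extensions_def)
  \<comment> \<open>The identity of \<open>E\<close> relates the extension to itself, so the
    extension belongs to its own class.\<close>
  have "iso_arr C (Id C E)"
    using Id_in_Hom[OF E] Comp_Id[OF Id_in_Hom[OF E]] unfolding iso_arr_def by (auto simp: Hom_eqs)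
  moreover have "Id C E \<cdot> i = i" "p \<cdot> Id C E = p"
    using x Id_Comp Comp_Id by (auto simp: extensions_def)
  ultimately have "((E, i, p), (E, i, p)) \<in> ext_equiv C X Y"
    using x Id_in_Hom[OF E] by (auto simp: ext_equiv_def)
  moreover have "ext_equiv C X Y `` {(E, i, p)} \<in> carrier (Ext1 C X Y)"
    using x by (simp add: Ext1_def quotientI)
  ultimately have "(E, i, p) \<in> \<one>\<^bsub>Ext1 C X Y\<^esub>" using assms(1) by auto
  then obtain j r where "is_biproduct C Y X E i j r p" by (auto simp: Ext1_def)
  note b = biproduct_Hom[OF this]
  show ?thesis by (rule that[OF b(3,5)])
qed

lemma pullback_section:
  assumes pb: "is_pullback C f g P p q" and f: "f \<in> Hom C M T" and g: "g \<in> Hom C N T"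
    and "epic C g" and hom: "Hom C T M = {Zero C T M}"
    and ext: "carrier (Ext1 C T P) = {\<one>\<^bsub>Ext1 C T P\<^esub>}"
  obtains s where "s \<in> Hom C M P" "p \<cdot> s = Id C M"
proof -
  note pq = pullback_Hom[OF pb f g]
  have M: "M \<in> Obj C" and N: "N \<in> Obj C" and T: "T \<in> Obj C" using Hom_Obj f g by blast+
  obtain K \<kappa> where \<kappa>: "\<kappa> \<in> Hom C K N" and ker: "is_kernel C \<kappa> g" using obtain_kernel[OF g] .
  have K: "K \<in> Obj C" using Hom_Obj[OF \<kappa>] by simp
  note cok = epic_is_cokernel_of_kernel[OF assms(4) g \<kappa> ker]
  obtain k where k: "k \<in> Hom C K P" "is_kernel C k p" "q \<cdot> k = \<kappa>"
    using pullback_kernel[OF pb f g \<kappa> ker] .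
  obtain E i t n where x: "(E, i, t) \<in> extensions C T P" and n: "n \<in> Hom C N E" "n \<cdot> \<kappa> = i \<cdot> k"
    using pushout_extension[OF g assms(4) \<kappa> ker k(1)] .
  have i: "i \<in> Hom C P E" using x by (simp add: extensions_def)
  obtain r where r: "r \<in> Hom C E P" "r \<cdot> i = Id C P" using extension_splits[OF ext x] .
  \<comment> \<open>The retraction of the pushout extension, restricted to \<open>N\<close>, extends
    \<open>k\<close> along \<open>\<kappa>\<close>.\<close>
  define h where "h = r \<cdot> n"
  have h: "h \<in> Hom C N P" unfolding h_def by (rule Comp_in_Hom[OF n(1) r(1)])
  have h\<kappa>: "h \<cdot> \<kappa> = k"
    unfolding h_def
    using Comp_assoc[OF \<kappa> n(1) r(1)] n(2) Comp_assoc[OF k(1) i r(1)] r(2) Id_Comp[OF k(1)] by simp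
  have "(p \<cdot> h) \<cdot> \<kappa> = Zero C K M"
    using Comp_assoc[OF \<kappa> h pq(1)] h\<kappa> kernel_Zero[OF k(2,1) pq(1)] by simp
  then obtain v where v: "v \<in> Hom C T M" "v \<cdot> g = p \<cdot> h"
    by (rule cokernel_factor[OF cok g \<kappa> Comp_in_Hom[OF h pq(1)]])
  \<comment> \<open>The only arrow from \<open>T\<close> to \<open>M\<close> is zero, so
    \<open>v\<close> is zero and \<open>h\<close> lands in the kernel of \<open>p\<close>.\<close>
  then have "p \<cdot> h = Zero C N M" using hom Zero_Comp[OF g M] by auto
  then obtain l where l: "l \<in> Hom C N K" "k \<cdot> l = h" by (rule kernel_factor[OF k(2,1) pq(1) h])
  have "k \<cdot> (l \<cdot> \<kappa>) = k \<cdot> Id C K"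
    using Comp_assoc[OF \<kappa> l(1) k(1)] l(2) h\<kappa> Comp_Id[OF k(1)] by simp
  then have l\<kappa>: "l \<cdot> \<kappa> = Id C K"
    by (rule monicD[OF kernel_monic[OF k(2,1) pq(1)] k(1) Comp_in_Hom[OF \<kappa> l(1)] Id_in_Hom[OF K]])
  have \<kappa>l: "\<kappa> \<cdot> l \<in> Hom C N N" by (rule Comp_in_Hom[OF l(1) \<kappa>])
  \<comment> \<open>With \<open>l\<close> a retraction of \<open>\<kappa>\<close>, the complementary
    idempotent \<open>e\<close> kills \<open>\<kappa>\<close> and descends along \<open>g\<close> to
    \<open>\<sigma>\<close>, the section of \<open>g\<close>.\<close>
  define e where "e = Id C N \<boxplus> Neg (\<kappa> \<cdot> l)"
  have e: "e \<in> Hom C N N" unfolding e_def by (rule Add_Hom[OF Id_in_Hom[OF N] Neg_Hom[OF \<kappa>l]])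
  have "e \<cdot> \<kappa> = Zero C K N" unfolding e_def by (rule diff_self_section(2)[OF \<kappa> l(1) l\<kappa>])
  then obtain \<sigma> where \<sigma>: "\<sigma> \<in> Hom C T N" "\<sigma> \<cdot> g = e" by (rule cokernel_factor[OF cok g \<kappa> e])
  \<comment> \<open>The term subtracted in \<open>e\<close> factors through \<open>\<kappa>\<close>,
    which \<open>g\<close> kills.\<close>
  have "g \<cdot> e = g"
    unfolding e_def
    using Comp_Add[OF Id_in_Hom[OF N] Neg_Hom[OF \<kappa>l] g] Comp_Neg[OF \<kappa>l g] Comp_assoc[OF l(1) \<kappa> g]
      kernel_Zero[OF ker \<kappa> g] Zero_Comp[OF l(1) T] Neg_Zero[OF N T] Comp_Id[OF g] Add_Zero[OF g]
    by simp
  then have "(g \<cdot> \<sigma>) \<cdot> g = Id C T \<cdot> g" using Comp_assoc[OF g \<sigma>(1) g] \<sigma>(2) Id_Comp[OF g] by simp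
  then have "g \<cdot> \<sigma> = Id C T"
    by (rule epicD[OF assms(4) g Comp_in_Hom[OF \<sigma>(1) g] Id_in_Hom[OF T]])
  \<comment> \<open>The identity of \<open>M\<close> and \<open>\<sigma> \<cdot> f\<close> form a
    cone over \<open>f\<close> and \<open>g\<close>; the arrow it induces into \<open>P\<close> is a
    section of \<open>p\<close>.\<close>
  then have "f \<cdot> Id C M = g \<cdot> (\<sigma> \<cdot> f)"
    using Comp_assoc[OF f \<sigma>(1) g] Id_Comp[OF f] Comp_Id[OF f] by simp
  then show ?thesis
    by (rule pullback_factor[OF pb f g Id_in_Hom[OF M] Comp_in_Hom[OF f \<sigma>(1)]]) (rule that)
qed

end

theorem theorem5p1:
  fixes C :: "('o, 'm, 'r) preadditive_scheme"
  assumes "abelian_category C"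
    and "f \<in> Hom C M T" and "epic C f"
    and "g \<in> Hom C N T" and "epic C g"
    and "is_pullback C f g P p q"
  shows "epic C p \<and> epic C q \<and>
    (carrier (Hom_group C T M) = {\<one>\<^bsub>Hom_group C T M\<^esub>} \<and>
     carrier (Ext1 C T P) = {\<one>\<^bsub>Ext1 C T P\<^esub>} \<longrightarrow>
       split_epic C p \<and>
       (\<exists>D. isomorphic C M D \<and> direct_summand C D P) \<and>
       (projective C P \<longrightarrow> projective C M))"
proof (intro conjI impI)
  interpret abelian_category C by fact
  note pb = assms(6) and f = assms(2) and g = assms(4)
  note p = pullback_Hom(1)[OF pb f g]
  show "epic C p" by (rule pullback_epic[OF pb f g assms(3,5)])
  show "epic C q" by (rule pullback_epic[OF pullback_sym[OF pb] g f assms(5,3)])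
  assume "carrier (Hom_group C T M) = {\<one>\<^bsub>Hom_group C T M\<^esub>} \<and>
    carrier (Ext1 C T P) = {\<one>\<^bsub>Ext1 C T P\<^esub>}"
  then have hom: "Hom C T M = {Zero C T M}" and ext: "carrier (Ext1 C T P) = {\<one>\<^bsub>Ext1 C T P\<^esub>}"
    by (simp_all add: Hom_group_def)
  obtain s where s: "s \<in> Hom C M P" "p \<cdot>\<^bsub>C\<^esub> s = Id C M"
    using pullback_section[OF pb f g assms(5) hom ext] .
  then show "split_epic C p" using split_epic_iff[OF p] by blast
  show "projective C P \<Longrightarrow> projective C M" by (rule projective_retract[OF _ p s])
  \<comment> \<open>The complement of \<open>M\<close> in \<open>P\<close> is the kernel of
    \<open>p\<close>, and the summand is \<open>M\<close> itself, embedded by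
    \<open>s\<close>.\<close>
  obtain K k where k: "k \<in> Hom C K P" "is_kernel C k p" using obtain_kernel[OF p] .
  obtain t where "is_biproduct C M K P s k p t" using section_biproduct[OF p s k] .
  then show "\<exists>D. isomorphic C M D \<and> direct_summand C D P"
    using isomorphic_refl Hom_Obj[OF f] unfolding direct_summand_def by blast
qed

end
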